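(* Let $R$ be a commutative local ring, and let $\varphi\in M_2(R)$. Then $\varphi$ is very clean in $M_2(R)$ if and only if at least one of the following holds: (1) $\frac12\in R$; or (2) $\varphi$ is strongly clean in $M_2(R)$.
   Context: Rings are associative with identity; $M_2(R)$ is the ring of $2\times 2$ matrices over $R$; $U(S)$ denotes the group of units of a ring $S$. An element $a$ of a ring $S$ is very clean if there exists an idempotent $e\in S$ such that $ae=ea$ and either $a-e\in U(S)$ or $a+e\in U(S)$. An element $a\in S$ is strongly clean if there exist an idempotent $e\in S$ and $u\in U(S)$ with $a=e+u$ and $ae=ea$. The condition $\frac12\in R$ means that $2=1+1$ is invertible in $R$. *)

theory Defs
  imports "HOL-Algebra.Ideal" "Jordan_Normal_Form.VS_Connect"
begin

text \<open>
  The base ring is a type of class \<open>comm_ring_1\<close>, viewed as a ring record through \<open>class_ring\<close>;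
  its ring of square matrices is \<open>ring_mat\<close>. The notions below are stated for arbitrary ring
  records, so that they apply to both. \<open>Units\<close> consists of the two-sided invertible elements.
\<close>

definition local_cring :: "('a, 'm) ring_scheme \<Rightarrow> bool" where
  "local_cring R \<longleftrightarrow> cring R \<and> (\<exists>!m. maximalideal m R)"

definition idempotent_elem :: "('a, 'm) ring_scheme \<Rightarrow> 'a \<Rightarrow> bool" where
  "idempotent_elem S e \<longleftrightarrow> e \<in> carrier S \<and> e \<otimes>\<^bsub>S\<^esub> e = e"

definition very_clean :: "('a, 'm) ring_scheme \<Rightarrow> 'a \<Rightarrow> bool" where
  "very_clean S a \<longleftrightarrow> a \<in> carrier S \<and>
     (\<exists>e. idempotent_elem S e \<and> a \<otimes>\<^bsub>S\<^esub> e = e \<otimes>\<^bsub>S\<^esub> a \<and>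
          (a \<ominus>\<^bsub>S\<^esub> e \<in> Units S \<or> a \<oplus>\<^bsub>S\<^esub> e \<in> Units S))"

definition strongly_clean :: "('a, 'm) ring_scheme \<Rightarrow> 'a \<Rightarrow> bool" where
  "strongly_clean S a \<longleftrightarrow> a \<in> carrier S \<and>
     (\<exists>e u. idempotent_elem S e \<and> u \<in> Units S \<and>
            a = e \<oplus>\<^bsub>S\<^esub> u \<and> a \<otimes>\<^bsub>S\<^esub> e = e \<otimes>\<^bsub>S\<^esub> a)"

end

theory Submission
  imports Defs "HOL-Algebra.Ring_Divisibility"
begin

text \<open>
  A square matrix over a commutative ring is invertible exactly when its determinant is a unit
  (\<open>Units_ring_mat_iff\<close>), and in a local ring a sum of non-units is a non-unit
  (\<open>local_cring_nonunits_add\<close>, a consequence of Zorn's lemma). This turns both directions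
  into statements about \<open>2 \<times> 2\<close> determinants.

  If \<open>2\<close> is a unit, then \<open>A\<close> is very clean with the idempotent \<open>0\<close> or \<open>1\<close>. The characteristic
  polynomial of \<open>A\<close> is a monic quadratic, so over the residue field it cannot vanish
  at all three of \<open>0\<close>, \<open>1\<close> and \<open>-1\<close>, which are distinct there. Without passing to the
  residue field: the second difference \<open>det (A - 1) + det (A + 1) - 2 det A = 2\<close> is a unit, so one
  of the three determinants is.

  If \<open>2\<close> is not a unit, then \<open>A + E\<close> and \<open>A - E\<close> agree modulo the maximal ideal, so they are
  invertible together and the sign in the definition of very clean makes no difference: very clean
  and strongly clean coincide. A strongly clean element is very clean over any ring.
\<close>

lemma (in cring) proper_ideal_subset_maximalideal:
  assumes I: "ideal I R" "I \<noteq> carrier R"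
  shows "\<exists>M. maximalideal M R \<and> I \<subseteq> M"
proof -
  \<comment> \<open>Properness is phrased through \<open>\<one>\<close>, a condition that visibly passes to unions of chains.\<close>
  let ?A = "{J. ideal J R \<and> I \<subseteq> J \<and> \<one> \<notin> J}"
  have proper: "\<one> \<notin> J \<longleftrightarrow> J \<noteq> carrier R" if "ideal J R" for J
    using ideal.one_imp_carrier[OF that] by auto
  have "\<exists>M\<in>?A. \<forall>X\<in>?A. M \<subseteq> X \<longrightarrow> X = M"
  proof (rule subset_Zorn_nonempty)
    show "?A \<noteq> {}" using I proper by blast
  next
    fix C assume C: "C \<noteq> {}" "subset.chain ?A C"
    then have "C \<subseteq> ?A" and "subset.chain {J. ideal J R} C"
      unfolding subset_chain_def by blast+
    then show "\<Union>C \<in> ?A" using chain_Union_is_ideal[of C] C(1) by auto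
  qed
  then obtain M where "M \<in> ?A" and max: "\<forall>X\<in>?A. M \<subseteq> X \<longrightarrow> X = M" ..
  then have M: "ideal M R" "I \<subseteq> M" "\<one> \<notin> M" by simp_all
  have "maximalideal M R"
  proof (rule maximalidealI[OF M(1)])
    show "carrier R \<noteq> M" using M(3) by auto
  next
    fix J assume J: "ideal J R" "M \<subseteq> J"
    then show "J = M \<or> J = carrier R"
      using max M(2) proper[OF J(1)] by blast
  qed
  with M(2) show ?thesis by blast
qed

text \<open>
  The principal ideals of two non-units lie in the same, unique maximal ideal, hence so does the sum.
\<close>

lemma local_cring_nonunits_add:
  fixes R (structure)
  assumes R: "local_cring R"
    and a: "a \<in> carrier R" "a \<notin> Units R"
    and b: "b \<in> carrier R" "b \<notin> Units R"
  shows "a \<oplus> b \<notin> Units R"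
proof
  interpret cring R using R by (simp add: local_cring_def)
  obtain M where M: "maximalideal M R" and uniq: "\<And>N. maximalideal N R \<Longrightarrow> N = M"
    using R by (auto simp: local_cring_def)
  interpret M: maximalideal M R by fact
  have mem: "x \<in> M" if "x \<in> carrier R" "x \<notin> Units R" for x
    using proper_ideal_subset_maximalideal[OF cgenideal_ideal[OF that(1)]]
      ideal_eq_carrier_iff[OF that(1)] that cgenideal_self[OF that(1)] uniq by blast
  assume U: "a \<oplus> b \<in> Units R"
  have "a \<oplus> b \<in> M" using mem[OF a] mem[OF b] by (rule M.a_closed)
  then have "inv (a \<oplus> b) \<otimes> (a \<oplus> b) \<in> M" using U by (intro M.I_l_closed) auto
  then have "\<one> \<in> M" using U by simp
  then show False using M.one_imp_carrier M.I_notcarr by simp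
qed

lemma Units_class_ring_iff:
  fixes x :: "'a::comm_ring_1"
  shows "x \<in> Units class_ring \<longleftrightarrow> x dvd 1"
  by (auto simp: Units_def dvd_def mult.commute)

lemma local_nonunits_add:
  fixes x y :: "'a::comm_ring_1"
  assumes "local_cring (class_ring :: 'a ring)" and "\<not> x dvd 1" "\<not> y dvd 1"
  shows "\<not> x + y dvd 1"
  using local_cring_nonunits_add[OF assms(1), of x y] assms(2,3)
  unfolding Units_class_ring_iff by simp

text \<open>Multiplicativity of the determinant gives one direction, the adjugate matrix the other.\<close>

lemma Units_ring_mat_iff:
  fixes A :: "'a::comm_ring_1 mat"
  assumes A: "A \<in> carrier_mat n n"
  shows "A \<in> Units (ring_mat TYPE('a) n b) \<longleftrightarrow> det A dvd 1"
proof
  assume "A \<in> Units (ring_mat TYPE('a) n b)"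
  then obtain B where B: "B \<in> carrier_mat n n" "A * B = 1\<^sub>m n"
    by (auto simp: Units_def ring_mat_simps)
  with det_mult[OF A B(1)] have "1 = det A * det B" by simp
  then show "det A dvd 1" by (rule dvdI)
next
  assume "det A dvd 1"
  then obtain c where c: "1 = det A * c" by (rule dvdE)
  let ?B = "c \<cdot>\<^sub>m adj_mat A"
  have "c \<cdot>\<^sub>m (det A \<cdot>\<^sub>m 1\<^sub>m n) = 1\<^sub>m n"
    using c by (intro eq_matI) (auto simp: mult.commute)
  then have "A * ?B = 1\<^sub>m n" "?B * A = 1\<^sub>m n" "?B \<in> carrier_mat n n"
    using adj_mat[OF A] A by (auto simp: mult_smult_distrib mult_smult_assoc_mat)
  then show "A \<in> Units (ring_mat TYPE('a) n b)"
    using A by (auto simp: Units_def ring_mat_simps)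
qed

lemma a_minus_ring_mat:
  fixes A B :: "'a::comm_ring_1 mat"
  assumes A: "A \<in> carrier_mat n n" and B: "B \<in> carrier_mat n n"
  shows "A \<ominus>\<^bsub>ring_mat TYPE('a) n b\<^esub> B = A - B"
proof -
  interpret ring "ring_mat TYPE('a) n b" by (rule ring_mat)
  have "\<ominus>\<^bsub>ring_mat TYPE('a) n b\<^esub> B = - B"
    using B by (intro minus_equality) (auto simp: ring_mat_simps uminus_l_inv_mat)
  then show ?thesis
    using A B by (simp add: a_minus_def ring_mat_simps minus_add_uminus_mat)
qed

lemma det_mat2:
  fixes A :: "'a::comm_ring_1 mat"
  assumes A: "A \<in> carrier_mat 2 2"
  shows "det A = A $$ (0,0) * A $$ (1,1) - A $$ (0,1) * A $$ (1,0)"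
proof -
  have "det (mat_delete A 0 0) = A $$ (1,1)" "det (mat_delete A 0 1) = A $$ (1,0)"
    using A by (auto simp: det_single mat_delete_def)
  then show ?thesis
    using laplace_expansion_row[OF A, of 0]
    by (simp add: cofactor_def numeral_2_eq_2)
qed

text \<open>
  As a function of \<open>t\<close>, \<open>det (A + t)\<close> is a monic quadratic polynomial, so its second difference
  at \<open>0\<close> with step \<open>1\<close> is \<open>2\<close>, whatever the trace and determinant of \<open>A\<close> are.
\<close>

lemma det_mat2_second_difference:
  fixes A :: "'a::comm_ring_1 mat"
  assumes A: "A \<in> carrier_mat 2 2"
  shows "det (A - 1\<^sub>m 2) + det (A + 1\<^sub>m 2) - 2 * det A = 2"
  using A by (simp add: det_mat2 minus_carrier_mat algebra_simps)

text \<open>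
  The determinant is a polynomial in the entries, and \<open>E\<close> and \<open>-E\<close> agree modulo \<open>2\<close>.
\<close>

lemma det_mat2_add_minus_cong:
  fixes A E :: "'a::comm_ring_1 mat"
  assumes A: "A \<in> carrier_mat 2 2" and E: "E \<in> carrier_mat 2 2"
  shows "2 dvd det (A + E) - det (A - E)"
proof
  show "det (A + E) - det (A - E) = 2 * (A $$ (0,0) * E $$ (1,1) + E $$ (0,0) * A $$ (1,1)
      - A $$ (0,1) * E $$ (1,0) - E $$ (0,1) * A $$ (1,0))"
    using A E by (simp add: det_mat2 minus_carrier_mat algebra_simps)
qed

lemma very_clean_mat_iff:
  fixes A :: "'a::comm_ring_1 mat"
  assumes A: "A \<in> carrier_mat n n"
  shows "very_clean (ring_mat TYPE('a) n b) A \<longleftrightarrow>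
    (\<exists>E \<in> carrier_mat n n. E * E = E \<and> A * E = E * A \<and> (det (A - E) dvd 1 \<or> det (A + E) dvd 1))"
proof -
  have "A \<ominus>\<^bsub>ring_mat TYPE('a) n b\<^esub> E \<in> Units (ring_mat TYPE('a) n b) \<longleftrightarrow> det (A - E) dvd 1"
    "A + E \<in> Units (ring_mat TYPE('a) n b) \<longleftrightarrow> det (A + E) dvd 1"
    if "E \<in> carrier_mat n n" for E
    using A that by (simp_all add: a_minus_ring_mat Units_ring_mat_iff minus_carrier_mat)
  then show ?thesis
    using A by (simp add: very_clean_def idempotent_elem_def ring_mat_simps Bex_def cong: conj_cong)
qed

lemma strongly_clean_mat_iff:
  fixes A :: "'a::comm_ring_1 mat"
  assumes A: "A \<in> carrier_mat n n"
  shows "strongly_clean (ring_mat TYPE('a) n b) A \<longleftrightarrow>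
    (\<exists>E \<in> carrier_mat n n. E * E = E \<and> A * E = E * A \<and> det (A - E) dvd 1)"
proof -
  have "(\<exists>U\<in>Units (ring_mat TYPE('a) n b). A = E + U) \<longleftrightarrow> det (A - E) dvd 1"
    if E: "E \<in> carrier_mat n n" for E
  proof -
    have "A = E + U \<longleftrightarrow> U = A - E" if "U \<in> Units (ring_mat TYPE('a) n b)" for U
    proof -
      have "U \<in> carrier_mat n n" using that by (simp add: Units_def ring_mat_simps)
      then show ?thesis using A E by (auto intro!: eq_matI)
    qed
    then have "(\<exists>U\<in>Units (ring_mat TYPE('a) n b). A = E + U) \<longleftrightarrow>
        A - E \<in> Units (ring_mat TYPE('a) n b)"
      by (simp cong: bex_cong)
    then show ?thesis using E by (simp add: Units_ring_mat_iff minus_carrier_mat)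
  qed
  moreover have "strongly_clean S a \<longleftrightarrow> a \<in> carrier S \<and>
      (\<exists>e. idempotent_elem S e \<and> a \<otimes>\<^bsub>S\<^esub> e = e \<otimes>\<^bsub>S\<^esub> a \<and> (\<exists>u\<in>Units S. a = e \<oplus>\<^bsub>S\<^esub> u))"
    for S :: "('a mat, 'b) ring_scheme" and a
    unfolding strongly_clean_def by blast
  ultimately show ?thesis
    using A by (simp add: idempotent_elem_def ring_mat_simps Bex_def cong: conj_cong)
qed

theorem theorem3p3:
  fixes \<phi> :: "'a :: comm_ring_1 mat"
  assumes "local_cring (class_ring :: 'a ring)"
    and "\<phi> \<in> carrier (ring_mat TYPE('a) 2 ())"
  shows "very_clean (ring_mat TYPE('a) 2 ()) \<phi> \<longleftrightarrow>
    (1 + 1 :: 'a) \<in> Units class_ring \<or> strongly_clean (ring_mat TYPE('a) 2 ()) \<phi>"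
proof -
  have \<phi>: "\<phi> \<in> carrier_mat 2 2" using assms(2) by (simp add: ring_mat_simps)
  note add = local_nonunits_add[OF assms(1)]
  have two: "(1 + 1 :: 'a) \<in> Units class_ring \<longleftrightarrow> (2 :: 'a) dvd 1"
    by (simp add: Units_class_ring_iff)
  show ?thesis
    unfolding very_clean_mat_iff[OF \<phi>] strongly_clean_mat_iff[OF \<phi>] two
  proof (intro iffI; (elim disjE)?)
    assume "\<exists>E \<in> carrier_mat 2 2. E * E = E \<and> \<phi> * E = E * \<phi> \<and>
      (det (\<phi> - E) dvd 1 \<or> det (\<phi> + E) dvd 1)"
    then obtain E where E: "E \<in> carrier_mat 2 2" "E * E = E" "\<phi> * E = E * \<phi>"
      and unit: "det (\<phi> - E) dvd 1 \<or> det (\<phi> + E) dvd 1" by blast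
    have "det (\<phi> - E) dvd 1" if "\<not> (2 :: 'a) dvd 1"
    proof (rule ccontr)
      assume nonunit: "\<not> det (\<phi> - E) dvd 1"
      have "\<not> det (\<phi> + E) - det (\<phi> - E) dvd 1"
        using det_mat2_add_minus_cong[OF \<phi> E(1)] that dvd_trans by blast
      from add[OF nonunit this] unit nonunit show False by simp
    qed
    with E show "2 dvd (1::'a) \<or>
      (\<exists>E \<in> carrier_mat 2 2. E * E = E \<and> \<phi> * E = E * \<phi> \<and> det (\<phi> - E) dvd 1)" by blast
  next
    assume "(2 :: 'a) dvd 1"
    have "det (\<phi> - 1\<^sub>m 2) dvd 1 \<or> det (\<phi> + 1\<^sub>m 2) dvd 1 \<or> det \<phi> dvd 1"
    proof (rule ccontr)
      assume *: "\<not> ?thesis"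
      then have "\<not> - 2 * det \<phi> dvd 1" using dvd_mult_right by blast
      with * have "\<not> (det (\<phi> - 1\<^sub>m 2) + det (\<phi> + 1\<^sub>m 2)) + - 2 * det \<phi> dvd 1"
        by (intro add) auto
      then show False
        using det_mat2_second_difference[OF \<phi>] \<open>2 dvd 1\<close> by simp
    qed
    then show "\<exists>E \<in> carrier_mat 2 2. E * E = E \<and> \<phi> * E = E * \<phi> \<and>
      (det (\<phi> - E) dvd 1 \<or> det (\<phi> + E) dvd 1)"
    proof (elim disjE)
      assume "det \<phi> dvd 1"
      then show ?thesis using \<phi> by (intro bexI[of _ "0\<^sub>m 2 2"]) auto
    qed (use \<phi> in \<open>auto intro!: bexI[of _ "1\<^sub>m 2"]\<close>)
  next
    assume "\<exists>E \<in> carrier_mat 2 2. E * E = E \<and> \<phi> * E = E * \<phi> \<and> det (\<phi> - E) dvd 1"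
    then show "\<exists>E \<in> carrier_mat 2 2. E * E = E \<and> \<phi> * E = E * \<phi> \<and>
      (det (\<phi> - E) dvd 1 \<or> det (\<phi> + E) dvd 1)" by blast
  qed
qed

end
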